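(* Let $M$ be a loopless matroid of rank $r$ on $n$ elements, and let $U_{r,n}$ be the uniform matroid of rank $r$ on $n$ elements. Then, for every integer $i\geq 0$, $$(-1)^i\left.\frac{\partial^i}{\partial s^i}Z^{\mathrm{top}}_M(s)\right|_{s=0}\ \geq\ (-1)^i\left.\frac{\partial^i}{\partial s^i}Z^{\mathrm{top}}_{U_{r,n}}(s)\right|_{s=0}.$$
   Context: For a loopless matroid $M$ on a finite ground set $E$, $\mathcal{L}(M)$ is its lattice of flats (with bottom $\varnothing$ and top $E$), $\mu_{F,G}$ is the Möbius function of $\mathcal{L}(M)$, and for a flat $F$, $M|_F$ and $M/F$ denote restriction to and contraction by $F$ (both are loopless). The characteristic polynomial is $\chi_M(x)=\sum_{F\in\mathcal{L}(M)}\mu_{\varnothing,F}\,x^{\mathrm{rk}(M)-\mathrm{rk}_M(F)}$, and for $\mathrm{rk}(M)>0$ the reduced characteristic polynomial is $\overline{\chi}_M(x)=\chi_M(x)/(x-1)$. The topological zeta function $Z^{\mathrm{top}}_M(s)\in\mathbb{Q}(s)$ is defined for all loopless matroids recursively as follows. If $\mathrm{rk}(M)=0$, then $Z^{\mathrm{top}}_M(s)=1$. If $\mathrm{rk}(M)=r>0$ and $|E|=n$, then $$Z^{\mathrm{top}}_M(s)=\frac{1}{ns+r}\sum_{F\in\mathcal{L}(M),\ F\neq E}Z^{\mathrm{top}}_{M|_F}(s)\,\overline{\chi}_{M/F}(1).$$ This rational function has no pole at $s=0$. The uniform matroid $U_{r,n}$ is the matroid on an $n$-element set whose bases are all the $r$-element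 subsets. *)

theory Defs
  imports
    "HOL-Computational_Algebra.Computational_Algebra"
    "HOL-Computational_Algebra.Field_as_Ring"
begin

section \<open>Matroids on finite ground sets\<close>

definition matroid_axioms :: "'a set \<Rightarrow> 'a set set \<Rightarrow> bool" where
  "matroid_axioms E I \<longleftrightarrow>
     finite E \<and> I \<subseteq> Pow E \<and> {} \<in> I \<and>
     (\<forall>X\<in>I. \<forall>Y\<subseteq>X. Y \<in> I) \<and>
     (\<forall>X\<in>I. \<forall>Y\<in>I. card X < card Y \<longrightarrow> (\<exists>y\<in>Y - X. insert y X \<in> I))"

typedef 'a matroid = "{(E :: 'a set, I :: 'a set set). matroid_axioms E I}"
  morphisms matroid_data Matroid
  by (rule exI[of _ "({}, {{}})"]) (auto simp: matroid_axioms_def)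

definition ground :: "'a matroid \<Rightarrow> 'a set" where
  "ground M = fst (matroid_data M)"

definition indeps :: "'a matroid \<Rightarrow> 'a set set" where
  "indeps M = snd (matroid_data M)"

lemma matroid_axioms_matroid: "matroid_axioms (ground M) (indeps M)"
  using matroid_data[of M] by (auto simp: ground_def indeps_def case_prod_beta)

lemma
  assumes "matroid_axioms E I"
  shows ground_Matroid: "ground (Matroid (E, I)) = E"
    and indeps_Matroid: "indeps (Matroid (E, I)) = I"
  using assms by (simp_all add: ground_def indeps_def Matroid_inverse)

lemma finite_ground [simp]: "finite (ground M)"
  using matroid_axioms_matroid[of M] by (simp add: matroid_axioms_def)

lemma indep_subset_ground: "X \<in> indeps M \<Longrightarrow> X \<subseteq> ground M"
  using matroid_axioms_matroid[of M] by (auto simp: matroid_axioms_def)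

lemma indep_finite: "X \<in> indeps M \<Longrightarrow> finite X"
  using indep_subset_ground finite_ground finite_subset by metis

lemma empty_indep [simp]: "{} \<in> indeps M"
  using matroid_axioms_matroid[of M] by (simp add: matroid_axioms_def)

lemma indep_mono: "X \<in> indeps M \<Longrightarrow> Y \<subseteq> X \<Longrightarrow> Y \<in> indeps M"
  using matroid_axioms_matroid[of M] by (auto simp: matroid_axioms_def)

lemma indep_augment:
  assumes "X \<in> indeps M" "Y \<in> indeps M" "card X < card Y"
  shows "\<exists>y\<in>Y - X. insert y X \<in> indeps M"
  using matroid_axioms_matroid[of M] assms by (simp add: matroid_axioms_def)

definition loopless :: "'a matroid \<Rightarrow> bool" where
  "loopless M \<longleftrightarrow> (\<forall>x\<in>ground M. {x} \<in> indeps M)"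

definition rk :: "'a matroid \<Rightarrow> 'a set \<Rightarrow> nat" where
  "rk M A = Max (card ` {X \<in> indeps M. X \<subseteq> A})"

abbreviation matroid_rank :: "'a matroid \<Rightarrow> nat" where
  "matroid_rank M \<equiv> rk M (ground M)"

definition flats :: "'a matroid \<Rightarrow> 'a set set" where
  "flats M = {F. F \<subseteq> ground M \<and> (\<forall>x\<in>ground M - F. rk M F < rk M (insert x F))}"

definition bases_of :: "'a matroid \<Rightarrow> 'a set \<Rightarrow> 'a set set" where
  "bases_of M A = {B \<in> indeps M. B \<subseteq> A \<and> (\<forall>C\<in>indeps M. B \<subseteq> C \<and> C \<subseteq> A \<longrightarrow> C = B)}"

abbreviation bases :: "'a matroid \<Rightarrow> 'a set set" where
  "bases M \<equiv> bases_of M (ground M)"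

lemma flat_subset_ground: "F \<in> flats M \<Longrightarrow> F \<subseteq> ground M"
  by (simp add: flats_def)

lemma flat_finite: "F \<in> flats M \<Longrightarrow> finite F"
  using flat_subset_ground finite_ground finite_subset by metis

lemma finite_flats [simp]: "finite (flats M)"
  by (rule finite_subset[of _ "Pow (ground M)"]) (auto simp: flats_def)

lemma ground_flat [simp]: "ground M \<in> flats M"
  by (simp add: flats_def)

lemma empty_flat:
  assumes "loopless M"
  shows "{} \<in> flats M"
proof -
  have "rk M {} < rk M {x}" if "x \<in> ground M" for x
  proof -
    have 0: "{X \<in> indeps M. X \<subseteq> {}} = {{}}" by auto
    have 1: "{X \<in> indeps M. X \<subseteq> {x}} = {{}, {x}}"
      using assms that by (auto simp: loopless_def subset_singleton_iff)
    show ?thesis unfolding rk_def 0 1 by simp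
  qed
  then show ?thesis by (simp add: flats_def)
qed

lemma bases_of_card_eq:
  assumes "B \<in> bases_of M A" "C \<in> bases_of M A"
  shows "card B = card C"
proof -
  have "\<not> card B < card C" if bases: "B \<in> bases_of M A" "C \<in> bases_of M A" for B C
  proof
    assume "card B < card C"
    then obtain y where y: "y \<in> C - B" "insert y B \<in> indeps M"
      using indep_augment[of B M C] bases unfolding bases_of_def by blast
    then have "insert y B = B"
      using that by (auto simp: bases_of_def)
    then show False using y by auto
  qed
  from this[OF assms] this[OF assms(2,1)] show ?thesis by simp
qed


section \<open>Restriction, contraction and uniform matroids\<close>

definition matroid_restrict :: "'a matroid \<Rightarrow> 'a set \<Rightarrow> 'a matroid" where
  "matroid_restrict M F = Matroid (ground M \<inter> F, {X \<in> indeps M. X \<subseteq> F})"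

definition matroid_contract :: "'a matroid \<Rightarrow> 'a set \<Rightarrow> 'a matroid" where
  "matroid_contract M F =
     Matroid (ground M - F, {X. X \<subseteq> ground M - F \<and> (\<exists>B\<in>bases_of M F. X \<union> B \<in> indeps M)})"

definition uniform_matroid :: "nat \<Rightarrow> nat \<Rightarrow> nat matroid" where
  "uniform_matroid r n = Matroid ({..<n}, {X. X \<subseteq> {..<n} \<and> card X \<le> r})"

lemma matroid_axioms_restrict:
  "matroid_axioms (ground M \<inter> F) {X \<in> indeps M. X \<subseteq> F}"
  unfolding matroid_axioms_def
proof (intro conjI ballI allI impI)
  show "{X \<in> indeps M. X \<subseteq> F} \<subseteq> Pow (ground M \<inter> F)"
    using indep_subset_ground by blast
next
  fix X Y assume "X \<in> {X \<in> indeps M. X \<subseteq> F}" "Y \<subseteq> X"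
  then show "Y \<in> {X \<in> indeps M. X \<subseteq> F}"
    using indep_mono[of X M Y] by auto
next
  fix X Y assume *: "X \<in> {X \<in> indeps M. X \<subseteq> F}" "Y \<in> {X \<in> indeps M. X \<subseteq> F}" "card X < card Y"
  then obtain y where "y \<in> Y - X" "insert y X \<in> indeps M"
    using indep_augment[of X M Y] by auto
  then show "\<exists>y\<in>Y - X. insert y X \<in> {X \<in> indeps M. X \<subseteq> F}"
    using * by auto
qed simp_all

lemma ex_basis_of: "\<exists>B. B \<in> bases_of M A"
proof -
  have "{X \<in> indeps M. X \<subseteq> A} \<subseteq> Pow (ground M)"
    using indep_subset_ground by blast
  then have fin: "finite {X \<in> indeps M. X \<subseteq> A}"
    by (rule finite_subset) simp
  have ne: "{X \<in> indeps M. X \<subseteq> A} \<noteq> {}"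
    using empty_indep[of M] by blast
  obtain B where B: "B \<in> {X \<in> indeps M. X \<subseteq> A}"
      and max: "\<forall>C\<in>{X \<in> indeps M. X \<subseteq> A}. B \<subseteq> C \<longrightarrow> B = C"
    using finite_has_maximal[OF fin ne] by (elim bexE)
  have "C = B" if "C \<in> indeps M" "B \<subseteq> C" "C \<subseteq> A" for C
    using bspec[OF max, of C] that by simp
  then have "B \<in> bases_of M A" using B unfolding bases_of_def by simp
  then show ?thesis ..
qed

lemma matroid_axioms_contract:
  "matroid_axioms (ground M - F)
     {X. X \<subseteq> ground M - F \<and> (\<exists>B\<in>bases_of M F. X \<union> B \<in> indeps M)}"
  (is "matroid_axioms _ ?I")
  unfolding matroid_axioms_def
proof (intro conjI ballI allI impI)
  show "{} \<in> ?I"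
    using ex_basis_of[of M F] by (auto simp: bases_of_def)
next
  fix X Y assume X: "X \<in> ?I" and "Y \<subseteq> X"
  then obtain B where B: "B \<in> bases_of M F" "X \<union> B \<in> indeps M" by auto
  then have "Y \<union> B \<in> indeps M"
    using indep_mono[of "X \<union> B" M "Y \<union> B"] \<open>Y \<subseteq> X\<close> by auto
  then show "Y \<in> ?I" using X B \<open>Y \<subseteq> X\<close> by auto
next
  fix X Y assume XY: "X \<in> ?I" "Y \<in> ?I" "card X < card Y"
  from XY obtain B C where
    B: "B \<in> bases_of M F" "X \<union> B \<in> indeps M" and C: "C \<in> bases_of M F" "Y \<union> C \<in> indeps M"
    by auto
  have sub: "B \<subseteq> F" "C \<subseteq> F" using B C by (auto simp: bases_of_def)
  have card_Un: "card (Z \<union> D) = card Z + card D"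
    if "Z \<subseteq> ground M - F" "D \<subseteq> F" "Z \<union> D \<in> indeps M" for Z D
    using indep_finite[OF that(3)] that(1,2) by (intro card_Un_disjoint) auto
  have "card (X \<union> B) = card X + card B" "card (Y \<union> C) = card Y + card C"
    using XY sub B(2) C(2) by (simp_all add: card_Un)
  then have "card (X \<union> B) < card (Y \<union> C)"
    using XY bases_of_card_eq[OF B(1) C(1)] by simp
  then obtain y where y: "y \<in> (Y \<union> C) - (X \<union> B)" "insert y (X \<union> B) \<in> indeps M"
    using indep_augment[OF B(2) C(2)] by auto
  have "y \<notin> C"
  proof
    assume "y \<in> C"
    have "insert y B \<in> indeps M"
      using indep_mono[OF y(2)] by auto
    moreover have "insert y B \<subseteq> F" using \<open>y \<in> C\<close> sub by auto
    ultimately have "insert y B = B"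
      using B(1) by (auto simp: bases_of_def)
    then show False using y by auto
  qed
  then have yY: "y \<in> Y - X" using y(1) by blast
  then have "insert y X \<subseteq> ground M - F" using XY by blast
  moreover have "insert y X \<union> B \<in> indeps M" using y(2) by simp
  ultimately have "insert y X \<in> ?I" using B(1) by blast
  with yY show "\<exists>y\<in>Y - X. insert y X \<in> ?I" by blast
qed auto

lemma matroid_axioms_uniform:
  "matroid_axioms {..<n::nat} {X. X \<subseteq> {..<n} \<and> card X \<le> r}"
  unfolding matroid_axioms_def
proof (intro conjI ballI allI impI)
  fix X Y assume X: "X \<in> {X. X \<subseteq> {..<n} \<and> card X \<le> r}" and "Y \<subseteq> X"
  then have "card Y \<le> card X" by (intro card_mono) (auto intro: finite_subset)
  then show "Y \<in> {X. X \<subseteq> {..<n} \<and> card X \<le> r}" using X \<open>Y \<subseteq> X\<close> by auto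
next
  fix X Y assume XY: "X \<in> {X. X \<subseteq> {..<n} \<and> card X \<le> r}" "Y \<in> {X. X \<subseteq> {..<n} \<and> card X \<le> r}"
    "card X < card Y"
  have fin: "finite X" using XY by (auto intro: finite_subset)
  then have "\<not> Y \<subseteq> X" using XY card_mono[of X Y] by auto
  then obtain y where "y \<in> Y - X" by blast
  then show "\<exists>y\<in>Y - X. insert y X \<in> {X. X \<subseteq> {..<n} \<and> card X \<le> r}"
    using XY fin by (intro bexI[of _ y]) auto
qed auto

lemmas ground_restrict [simp] =
  ground_Matroid[OF matroid_axioms_restrict, folded matroid_restrict_def]
lemmas indeps_restrict =
  indeps_Matroid[OF matroid_axioms_restrict, folded matroid_restrict_def]
lemmas ground_contract [simp] =
  ground_Matroid[OF matroid_axioms_contract, folded matroid_contract_def]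
lemmas indeps_contract =
  indeps_Matroid[OF matroid_axioms_contract, folded matroid_contract_def]
lemmas ground_uniform [simp] =
  ground_Matroid[OF matroid_axioms_uniform, folded uniform_matroid_def]
lemmas indeps_uniform =
  indeps_Matroid[OF matroid_axioms_uniform, folded uniform_matroid_def]

lemma bases_uniform:
  assumes "r \<le> n"
  shows "bases (uniform_matroid r n) = {B. B \<subseteq> {..<n} \<and> card B = r}"
proof (intro equalityI subsetI)
  fix B assume "B \<in> bases (uniform_matroid r n)"
  then have B: "B \<subseteq> {..<n}" "card B \<le> r"
    and max: "\<And>C. C \<subseteq> {..<n} \<Longrightarrow> card C \<le> r \<Longrightarrow> B \<subseteq> C \<Longrightarrow> C = B"
    by (auto simp: bases_of_def indeps_uniform)
  have "card B = r"
  proof (rule ccontr)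
    assume "card B \<noteq> r"
    then have less: "card B < r" using B by simp
    have fin: "finite B" using B finite_subset by auto
    have "B \<noteq> {..<n}" using less assms by auto
    then obtain y where "y \<in> {..<n} - B" using B by blast
    then show False using max[of "insert y B"] B less fin by auto
  qed
  then show "B \<in> {B. B \<subseteq> {..<n} \<and> card B = r}" using B by simp
next
  fix B assume B: "B \<in> {B. B \<subseteq> {..<n} \<and> card B = r}"
  have "C = B" if "C \<subseteq> {..<n}" "card C \<le> r" "B \<subseteq> C" for C
    using card_seteq[of C B] finite_subset[OF that(1)] that B by auto
  then show "B \<in> bases (uniform_matroid r n)"
    using B by (auto simp: bases_of_def indeps_uniform)
qed


section \<open>Moebius function and characteristic polynomial\<close>

text \<open>Only the values at pairs of flats are meaningful; the guard keeps the recursion inside the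
  finite lattice of flats.\<close>
function moebius :: "'a matroid \<Rightarrow> 'a set \<Rightarrow> 'a set \<Rightarrow> int" where
  "moebius M F G =
     (if F \<notin> flats M \<or> G \<notin> flats M \<or> \<not> F \<subseteq> G then 0
      else if F = G then 1
      else - (\<Sum>H\<in>{H \<in> flats M. F \<subseteq> H \<and> H \<subset> G}. moebius M F H))"
  by pat_completeness auto
termination
  by (relation "Wellfounded.measure (\<lambda>(M, F, G). card G)")
     (auto intro!: psubset_card_mono flat_finite)

declare moebius.simps [simp del]

text \<open>The bottom flat is written as \<open>{}\<close>, which is correct for loopless matroids only.\<close>
definition char_poly :: "'a matroid \<Rightarrow> int poly" where
  "char_poly M = (\<Sum>F\<in>flats M. monom (moebius M {} F) (matroid_rank M - rk M F))"

definition reduced_char_poly :: "'a matroid \<Rightarrow> int poly" where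
  "reduced_char_poly M = char_poly M div [:-1, 1:]"

text \<open>The division is exact.\<close>
lemma char_poly_eq_reduced:
  assumes "loopless M" "matroid_rank M > 0"
  shows "char_poly M = [:-1, 1:] * reduced_char_poly M"
proof -
  have ne: "{} \<noteq> ground M"
  proof
    assume "{} = ground M"
    moreover have "{X \<in> indeps M. X \<subseteq> {}} = {{}}" by auto
    ultimately show False using assms(2) by (simp add: rk_def)
  qed
  have "flats M = insert (ground M) {H \<in> flats M. {} \<subseteq> H \<and> H \<subset> ground M}"
    by (auto dest: flat_subset_ground)
  then have "(\<Sum>F\<in>flats M. moebius M {} F) =
      moebius M {} (ground M) + (\<Sum>F\<in>{H \<in> flats M. {} \<subseteq> H \<and> H \<subset> ground M}. moebius M {} F)"
    by (metis (no_types, lifting) finite_flats finite_insert mem_Collect_eq psubset_eq sum.insert)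
  also have "\<dots> = 0"
    using ne empty_flat[OF assms(1)] by (subst moebius.simps) simp
  finally have "poly (char_poly M) 1 = 0"
    by (simp add: char_poly_def poly_sum poly_monom)
  then have "[:-1, 1:] dvd char_poly M"
    by (simp add: poly_eq_0_iff_dvd)
  then show ?thesis unfolding reduced_char_poly_def by (rule dvd_mult_div_cancel[symmetric])
qed


section \<open>Rational functions\<close>

text \<open>The field \<open>\<rat>(s)\<close> is \<^typ>\<open>rat poly fract\<close>. \<^const>\<open>quot_of_fract\<close> returns
  numerator and denominator in lowest terms.\<close>

definition ratfun_deriv :: "rat poly fract \<Rightarrow> rat poly fract" where
  "ratfun_deriv f =
     (case quot_of_fract f of (p, q) \<Rightarrow> Fract (pderiv p * q - p * pderiv q) (q ^ 2))"

text \<open>Since \<open>p\<close> and \<open>q\<close> are coprime, this is the value of \<open>f\<close> at \<open>a\<close> whenever \<open>f\<close> has no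
  pole there; at a pole it is 0.\<close>
definition ratfun_eval :: "rat poly fract \<Rightarrow> rat \<Rightarrow> rat" where
  "ratfun_eval f a = (case quot_of_fract f of (p, q) \<Rightarrow> poly p a / poly q a)"

lemma ratfun_repr:
  assumes "q \<noteq> 0" "quot_of_fract (Fract p q) = (p', q')"
  shows "p * q' = p' * q" "q' \<noteq> 0" "coprime p' q'"
proof -
  have q': "q' \<noteq> 0"
    using snd_quot_of_fract_nonzero[of "Fract p q"] assms(2) by simp
  have "Fract p q = Fract p' q'"
    using quot_to_fract_quot_of_fract[of "Fract p q"] assms(2) by (simp add: quot_to_fract_def)
  then show "p * q' = p' * q"
    using assms(1) q' by (simp add: eq_fract)
  show "q' \<noteq> 0" by (fact q')
  show "coprime p' q'"
    using coprime_quot_of_fract[of "Fract p q"] assms(2) by simp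
qed

lemma ratfun_eval_Fract:
  assumes "poly q a \<noteq> 0"
  shows "ratfun_eval (Fract p q) a = poly p a / poly q a"
proof -
  obtain p' q' where pq: "quot_of_fract (Fract p q) = (p', q')" by fastforce
  have "q \<noteq> 0" using assms by auto
  note r = ratfun_repr[OF this pq]
  have "q' dvd p' * q" using r(1) by (metis dvd_triv_right)
  then have "q' dvd q" using r(3) by (simp add: coprime_dvd_mult_right_iff coprime_commute)
  then have "poly q' a \<noteq> 0" using assms by (auto elim!: dvdE)
  moreover have "poly p a * poly q' a = poly p' a * poly q a"
    using arg_cong[OF r(1), of "\<lambda>f. poly f a"] by simp
  ultimately show ?thesis
    using assms by (simp add: ratfun_eval_def pq frac_eq_eq)
qed

lemma ratfun_deriv_Fract:
  assumes "q \<noteq> 0"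
  shows "ratfun_deriv (Fract p q) = Fract (pderiv p * q - p * pderiv q) (q ^ 2)"
proof -
  obtain p' q' where pq: "quot_of_fract (Fract p q) = (p', q')" by fastforce
  note r = ratfun_repr[OF assms pq]
  have d: "pderiv p * q' + p * pderiv q' = pderiv p' * q + p' * pderiv q"
    using arg_cong[OF r(1), of pderiv] by (simp add: pderiv_mult algebra_simps)
  have "(pderiv p' * q' - p' * pderiv q') * q ^ 2 = (pderiv p * q - p * pderiv q) * q' ^ 2"
  proof -
    have "(pderiv p' * q' - p' * pderiv q') * q ^ 2 =
        q * q' * (pderiv p' * q) - (p' * q) * pderiv q' * q"
      by (simp add: algebra_simps power2_eq_square)
    also have "pderiv p' * q = pderiv p * q' + p * pderiv q' - p' * pderiv q"
      using d by (simp add: algebra_simps)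
    also have "q * q' * \<dots> - (p' * q) * pderiv q' * q =
        q * q' ^ 2 * pderiv p + (p * q' - p' * q) * pderiv q' * q - q' * pderiv q * (p' * q)"
      by (simp add: algebra_simps power2_eq_square)
    also have "\<dots> = (pderiv p * q - p * pderiv q) * q' ^ 2"
      unfolding r(1)[symmetric] by (simp add: algebra_simps power2_eq_square)
    finally show ?thesis .
  qed
  then show ?thesis
    using assms r(2) by (simp add: ratfun_deriv_def pq eq_fract)
qed


section \<open>The topological zeta function\<close>

function ztop :: "'a matroid \<Rightarrow> rat poly fract" where
  "ztop M =
     (if matroid_rank M = 0 then 1
      else 1 / to_fract [:of_nat (matroid_rank M), of_nat (card (ground M)):] *
        (\<Sum>F\<in>flats M - {ground M}.
           ztop (matroid_restrict M F) *
           of_int (poly (reduced_char_poly (matroid_contract M F)) 1)))"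
  by pat_completeness auto
termination
proof (relation "Wellfounded.measure (\<lambda>M. card (ground M))")
  fix M :: "'a matroid" and F
  assume "F \<in> flats M - {ground M}"
  then have "ground M \<inter> F \<subset> ground M" by (auto dest: flat_subset_ground)
  then show "(matroid_restrict M F, M) \<in> Wellfounded.measure (\<lambda>M. card (ground M))"
    by (simp add: psubset_card_mono)
qed simp

declare ztop.simps [simp del]

end

(* For loopless M the i-th Taylor coefficient of the zeta function at 0 is, up to the sign (-1)^i,
     sum over (e_1, ..., e_i) in E^i of prod_{k=1..i} 1 / rk {e_1, ..., e_k}.
   Both sides satisfy the same recursion: in terms of coefficients the definition of the zeta
   function asks for the sum of the reduced characteristic polynomials of M/F at 1 over the flats
   F that contain e_1, ..., e_i, F different from E, and by Moebius inversion this sum is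
   rk M - rk {e_1, ..., e_i}.
   All terms are positive and antitone in the rank function, and rk A is at most min r |A|, which
   is the rank of A in the uniform matroid. *)

theory Submission
  imports Defs
begin

section \<open>Rank and closure\<close>

lemma finite_indeps_below: "finite {X \<in> indeps M. X \<subseteq> A}"
  by (rule finite_subset[of _ "Pow (ground M)"]) (use indep_subset_ground in auto)

lemma card_le_rk: "X \<in> indeps M \<Longrightarrow> X \<subseteq> A \<Longrightarrow> card X \<le> rk M A"
  unfolding rk_def using finite_indeps_below[of M A] by (intro Max_ge) auto

lemma rk_attained:
  obtains X where "X \<in> indeps M" "X \<subseteq> A" "card X = rk M A"
proof -
  have "rk M A \<in> card ` {X \<in> indeps M. X \<subseteq> A}"
    unfolding rk_def using finite_indeps_below[of M A] empty_indep[of M]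
    by (intro Max_in) blast+
  then show thesis using that by auto
qed

lemma rk_le: "(\<And>X. X \<in> indeps M \<Longrightarrow> X \<subseteq> A \<Longrightarrow> card X \<le> k) \<Longrightarrow> rk M A \<le> k"
  by (metis rk_attained)

lemma rk_mono: "A \<subseteq> B \<Longrightarrow> rk M A \<le> rk M B"
  by (rule rk_le) (use card_le_rk in blast)

lemma rk_empty [simp]: "rk M {} = 0"
  using rk_le[of M "{}" 0] by auto

lemma rk_le_card: "finite A \<Longrightarrow> rk M A \<le> card A"
  by (rule rk_le) (simp add: card_mono)

text \<open>A larger independent subset of \<open>A\<close> would augment \<open>B\<close> inside
  \<open>A\<close>, against maximality.\<close>

lemma rk_basis_of:
  assumes "B \<in> bases_of M A"
  shows "rk M A = card B"
proof (rule antisym)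
  show "card B \<le> rk M A"
    using assms by (intro card_le_rk) (auto simp: bases_of_def)
  show "rk M A \<le> card B"
  proof (rule rk_le, rule ccontr)
    fix X assume X: "X \<in> indeps M" "X \<subseteq> A" "\<not> card X \<le> card B"
    then obtain y where y: "y \<in> X - B" "insert y B \<in> indeps M"
      using indep_augment[of B M X] assms by (auto simp: bases_of_def)
    then have "insert y B = B"
      using assms X by (auto simp: bases_of_def)
    then show False using y by auto
  qed
qed

lemma basis_of_extend:
  assumes "X \<in> indeps M" "X \<subseteq> A"
  obtains B where "X \<subseteq> B" "B \<in> bases_of M A"
proof -
  obtain B where B: "B \<in> {X \<in> indeps M. X \<subseteq> A}" "X \<subseteq> B"
      and max: "\<forall>C\<in>{X \<in> indeps M. X \<subseteq> A}. B \<subseteq> C \<longrightarrow> B = C"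
    using finite_has_maximal2[OF finite_indeps_below, of X M A] assms by auto
  have "C = B" if "C \<in> indeps M" "B \<subseteq> C" "C \<subseteq> A" for C
    using bspec[OF max, of C] that by simp
  then have "B \<in> bases_of M A" using B unfolding bases_of_def by simp
  then show thesis using that B(2) by blast
qed

text \<open>A largest independent subset of \<open>insert x A\<close> augments \<open>B\<close>;
  since \<open>B\<close> is maximal in \<open>A\<close>, the added element can only be
  \<open>x\<close>.\<close>

lemma rk_insert_greaterD:
  assumes "B \<in> bases_of M A" "rk M A < rk M (insert x A)"
  shows "x \<notin> B" "insert x B \<in> indeps M"
proof -
  obtain X where X: "X \<in> indeps M" "X \<subseteq> insert x A" "card X = rk M (insert x A)"
    by (rule rk_attained)
  have B: "B \<in> indeps M" "B \<subseteq> A"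
    using assms(1) by (auto simp: bases_of_def)
  have "card B < card X" using X assms rk_basis_of by metis
  then obtain y where y: "y \<in> X - B" "insert y B \<in> indeps M"
    using indep_augment B(1) X(1) by blast
  have "y \<notin> A"
  proof
    assume "y \<in> A"
    then have "insert y B = B"
      using assms(1) B(2) y(2) by (auto simp: bases_of_def)
    then show False using y by auto
  qed
  then have "y = x" using X y by auto
  then show "x \<notin> B" "insert x B \<in> indeps M" using y by auto
qed

text \<open>The single-element form of submodularity: a basis of \<open>A\<close> extends to a basis
  of \<open>F\<close>, and if \<open>x\<close> can be added to the latter, it can be added to the
  former.\<close>

lemma rk_insert_greater_antimono:
  assumes "A \<subseteq> F" "rk M F < rk M (insert x F)"
  shows "rk M A < rk M (insert x A)"
proof -
  obtain B where B: "B \<in> bases_of M A" using ex_basis_of by blast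
  then obtain C where C: "B \<subseteq> C" "C \<in> bases_of M F"
    using basis_of_extend[of B M F] assms(1) by (auto simp: bases_of_def)
  note x = rk_insert_greaterD[OF C(2) assms(2)]
  have "insert x B \<in> indeps M" using indep_mono[OF x(2)] C(1) by blast
  moreover have "finite B" using indep_finite[of B M] B by (simp add: bases_of_def)
  moreover have "insert x B \<subseteq> insert x A" using B by (auto simp: bases_of_def)
  ultimately have "Suc (card B) \<le> rk M (insert x A)"
    using card_le_rk[of "insert x B" M "insert x A"] x(1) C(1) by (metis card_insert_disjoint subsetD)
  then show ?thesis using rk_basis_of[OF B] by simp
qed

section \<open>Closure of a set\<close>

definition closure :: "'a matroid \<Rightarrow> 'a set \<Rightarrow> 'a set" where
  "closure M A = {x \<in> ground M. rk M (insert x A) = rk M A}"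

lemma subset_closure: "A \<subseteq> ground M \<Longrightarrow> A \<subseteq> closure M A"
  by (auto simp: closure_def insert_absorb)

text \<open>A basis \<open>B\<close> of \<open>A\<close> stays maximal in the closure: an element
  extending it would raise the rank of \<open>A\<close>, which elements of the closure do
  not.\<close>

lemma rk_closure:
  assumes "A \<subseteq> ground M"
  shows "rk M (closure M A) = rk M A"
proof -
  obtain B where B: "B \<in> bases_of M A" using ex_basis_of by blast
  have "B \<subseteq> closure M A"
    using B subset_closure[OF assms] by (auto simp: bases_of_def)
  then obtain C where C: "B \<subseteq> C" "C \<in> bases_of M (closure M A)"
    using basis_of_extend[of B M "closure M A"] B by (auto simp: bases_of_def)
  have "C \<subseteq> B"
  proof (rule ccontr)
    assume "\<not> C \<subseteq> B"
    then obtain x where x: "x \<in> C" "x \<notin> B" by blast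
    then have "insert x B \<in> indeps M"
      using indep_mono[of C M "insert x B"] C by (auto simp: bases_of_def)
    moreover have "insert x B \<subseteq> insert x A" using B by (auto simp: bases_of_def)
    moreover have "finite B" using B indep_finite by (auto simp: bases_of_def)
    ultimately have "Suc (card B) \<le> rk M (insert x A)"
      using card_le_rk[of "insert x B" M "insert x A"] x by auto
    moreover have "rk M (insert x A) = rk M A"
      using x C by (auto simp: bases_of_def closure_def)
    ultimately show False using rk_basis_of[OF B] by simp
  qed
  then have "C = B" using C by blast
  then show ?thesis using rk_basis_of[OF B] rk_basis_of[OF C(2)] by simp
qed

lemma closure_flat:
  assumes "A \<subseteq> ground M"
  shows "closure M A \<in> flats M"
proof -
  have "rk M (closure M A) < rk M (insert x (closure M A))"
    if "x \<in> ground M - closure M A" for x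
  proof -
    have "rk M A < rk M (insert x A)"
      using that rk_mono[OF subset_insertI, of M A x] by (auto simp: closure_def)
    also have "\<dots> \<le> rk M (insert x (closure M A))"
      using subset_closure[OF assms] by (intro rk_mono) auto
    finally show ?thesis using rk_closure[OF assms] by simp
  qed
  then show ?thesis by (auto simp: flats_def closure_def)
qed

text \<open>An element of the closure outside \<open>F\<close> would raise the rank of
  \<open>F\<close>, hence that of \<open>A\<close>. With \<open>closure_flat\<close> this makes the
  closure the least flat containing \<open>A\<close>.\<close>

lemma closure_subset_flat_iff:
  assumes "A \<subseteq> ground M" "F \<in> flats M"
  shows "closure M A \<subseteq> F \<longleftrightarrow> A \<subseteq> F"
proof
  show "closure M A \<subseteq> F \<Longrightarrow> A \<subseteq> F" using subset_closure[OF assms(1)] by simp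
  assume "A \<subseteq> F"
  then show "closure M A \<subseteq> F"
    using assms(2) rk_insert_greater_antimono[of A F M]
    by (fastforce simp: closure_def flats_def)
qed

lemma loopless_rk_pos:
  assumes "loopless M" "A \<subseteq> ground M" "A \<noteq> {}"
  shows "0 < rk M A"
proof -
  obtain x where "x \<in> A" using assms(3) by blast
  then show ?thesis
    using card_le_rk[of "{x}" M A] assms by (auto simp: loopless_def)
qed

lemma flat_rk_less:
  assumes "F \<in> flats M" "F \<noteq> ground M"
  shows "rk M F < matroid_rank M"
proof -
  obtain x where x: "x \<in> ground M - F" using assms by (auto simp: flats_def)
  then have "rk M F < rk M (insert x F)" using assms by (auto simp: flats_def)
  also have "\<dots> \<le> matroid_rank M"
    using x assms by (intro rk_mono) (auto simp: flats_def)
  finally show ?thesis .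
qed

section \<open>Minors\<close>

lemma rk_restrict: "A \<subseteq> F \<Longrightarrow> rk (matroid_restrict M F) A = rk M A"
  unfolding rk_def by (rule arg_cong[of _ _ "\<lambda>S. Max (card ` S)"]) (auto simp: indeps_restrict)

lemma loopless_restrict: "loopless M \<Longrightarrow> loopless (matroid_restrict M F)"
  by (auto simp: loopless_def indeps_restrict)

text \<open>The sum form avoids subtraction on \<open>nat\<close>. For \<open>\<le>\<close>, join an
  independent set of the contraction with a basis of \<open>F\<close>; for \<open>\<ge>\<close>,
  extend a basis of \<open>F\<close> to one of \<open>X \<union> F\<close> and remove it
  again.\<close>

lemma rk_contract:
  assumes "X \<subseteq> ground M - F"
  shows "rk (matroid_contract M F) X + rk M F = rk M (X \<union> F)"
proof (rule antisym)
  obtain Y where Y: "Y \<in> indeps (matroid_contract M F)" "Y \<subseteq> X"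
      "card Y = rk (matroid_contract M F) X"
    by (rule rk_attained)
  then obtain B where B: "B \<in> bases_of M F" "Y \<union> B \<in> indeps M"
    by (auto simp: indeps_contract)
  have "card Y + card B = card (Y \<union> B)"
    using indep_finite[OF B(2)] B(1) Y(2) assms
    by (intro card_Un_disjoint[symmetric]) (auto simp: bases_of_def)
  also have "\<dots> \<le> rk M (X \<union> F)"
    using B Y(2) by (intro card_le_rk) (auto simp: bases_of_def)
  finally show "rk (matroid_contract M F) X + rk M F \<le> rk M (X \<union> F)"
    using Y(3) rk_basis_of[OF B(1)] by simp
next
  obtain B where B: "B \<in> bases_of M F" using ex_basis_of by blast
  then obtain C where C: "B \<subseteq> C" "C \<in> bases_of M (X \<union> F)"
    using basis_of_extend[of B M "X \<union> F"] by (auto simp: bases_of_def)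
  then have Ci: "C \<in> indeps M" "C \<subseteq> X \<union> F" by (auto simp: bases_of_def)
  have "C \<inter> F \<in> indeps M" using indep_mono[OF Ci(1)] by auto
  then have "C \<inter> F = B"
    using B C(1) by (auto simp: bases_of_def)
  then have sub: "C - B \<subseteq> X" using Ci(2) by auto
  have "C - B \<union> B \<in> indeps M" using C(1) Ci(1) by (simp add: Un_absorb2)
  then have "C - B \<in> indeps (matroid_contract M F)"
    using sub assms B unfolding indeps_contract by blast
  then have "card (C - B) \<le> rk (matroid_contract M F) X"
    using sub by (rule card_le_rk)
  moreover have "card (C - B) + card B = card C"
    using C(1) card_mono[OF indep_finite[OF Ci(1)] C(1)] finite_subset[OF C(1) indep_finite[OF Ci(1)]]
    by (simp add: card_Diff_subset)
  ultimately show "rk M (X \<union> F) \<le> rk (matroid_contract M F) X + rk M F"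
    using rk_basis_of[OF B] rk_basis_of[OF C(2)] by simp
qed

text \<open>Ranks in the contraction are ranks of unions with \<open>F\<close> shifted by the
  constant \<open>rk M F\<close>, so strict increases correspond.\<close>

lemma flats_contract_iff:
  assumes "F \<subseteq> ground M" "K \<subseteq> ground M - F"
  shows "K \<in> flats (matroid_contract M F) \<longleftrightarrow> K \<union> F \<in> flats M"
proof -
  have "rk (matroid_contract M F) K < rk (matroid_contract M F) (insert x K) \<longleftrightarrow>
      rk M (K \<union> F) < rk M (insert x (K \<union> F))" if "x \<in> ground M - F - K" for x
    using rk_contract[of K M F] rk_contract[of "insert x K" M F] that assms by auto
  then show ?thesis using assms by (auto simp: flats_def)
qed

lemma bij_betw_flats_contract:
  assumes "F \<subseteq> ground M"
  shows "bij_betw (\<lambda>K. K \<union> F) (flats (matroid_contract M F)) {H \<in> flats M. F \<subseteq> H}"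
proof (rule bij_betwI[where g = "\<lambda>H. H - F"])
  show "(\<lambda>K. K \<union> F) \<in> flats (matroid_contract M F) \<rightarrow> {H \<in> flats M. F \<subseteq> H}"
  proof
    fix K assume K: "K \<in> flats (matroid_contract M F)"
    then have "K \<subseteq> ground M - F" using flat_subset_ground[OF K] by simp
    then show "K \<union> F \<in> {H \<in> flats M. F \<subseteq> H}"
      using flats_contract_iff[OF assms] K by blast
  qed
  show "(\<lambda>H. H - F) \<in> {H \<in> flats M. F \<subseteq> H} \<rightarrow> flats (matroid_contract M F)"
  proof
    fix H assume H: "H \<in> {H \<in> flats M. F \<subseteq> H}"
    then have "H - F \<subseteq> ground M - F" using flat_subset_ground by blast
    moreover have "H - F \<union> F \<in> flats M" using H by (simp add: Un_absorb2)
    ultimately show "H - F \<in> flats (matroid_contract M F)"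
      using flats_contract_iff[OF assms] by blast
  qed
  show "K \<union> F - F = K" if "K \<in> flats (matroid_contract M F)" for K
    using flat_subset_ground[OF that] by auto
qed auto

text \<open>Outside a flat every element raises the rank and so extends any basis of
  \<open>F\<close>. This makes \<open>{}\<close> the bottom flat of the contraction, as
  \<open>char_poly\<close> presupposes.\<close>

lemma loopless_contract:
  assumes "F \<in> flats M"
  shows "loopless (matroid_contract M F)"
  unfolding loopless_def
proof
  fix x assume "x \<in> ground (matroid_contract M F)"
  then have x: "x \<in> ground M - F" by simp
  then have *: "rk M F < rk M (insert x F)" using assms by (auto simp: flats_def)
  obtain B where B: "B \<in> bases_of M F" using ex_basis_of by blast
  then show "{x} \<in> indeps (matroid_contract M F)"
    using rk_insert_greaterD(2)[OF B *] x by (auto simp: indeps_contract)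
qed

section \<open>Moebius inversion\<close>

lemma moebius_sum_upper:
  assumes "F \<in> flats M" "G \<in> flats M" "F \<subseteq> G"
  shows "(\<Sum>H\<in>{H \<in> flats M. F \<subseteq> H \<and> H \<subseteq> G}. moebius M F H) = (if F = G then 1 else 0)"
proof -
  have "{H \<in> flats M. F \<subseteq> H \<and> H \<subseteq> G} = insert G {H \<in> flats M. F \<subseteq> H \<and> H \<subset> G}"
    using assms by auto
  then have "(\<Sum>H\<in>{H \<in> flats M. F \<subseteq> H \<and> H \<subseteq> G}. moebius M F H) =
      moebius M F G + (\<Sum>H\<in>{H \<in> flats M. F \<subseteq> H \<and> H \<subset> G}. moebius M F H)"
    by (simp only:) (subst sum.insert, auto)
  also have "\<dots> = (if F = G then 1 else 0)"
  proof (cases "F = G")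
    case True
    then have "{H \<in> flats M. F \<subseteq> H \<and> H \<subset> G} = {}" by auto
    with True assms show ?thesis by (simp only: sum.empty) (simp add: moebius.simps)
  next
    case False
    with assms show ?thesis by (subst moebius.simps) simp
  qed
  finally show ?thesis .
qed

text \<open>\<open>moebius\<close> recurses on its upper argument, so
  \<open>moebius_sum_upper\<close> is nearly its definition. Summing over the lower argument needs
  that a one-sided inverse in the incidence algebra is two-sided; the proof evaluates one
  convolution in two ways.\<close>

lemma moebius_sum_lower:
  assumes "F \<in> flats M" "G \<in> flats M" "F \<subseteq> G"
  shows "(\<Sum>H\<in>{H \<in> flats M. F \<subseteq> H \<and> H \<subseteq> G}. moebius M H G) = (if F = G then 1 else 0)"
  using assms
proof (induction "card (G - F)" arbitrary: F rule: less_induct)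
  case less
  let ?I = "\<lambda>A B. {H \<in> flats M. A \<subseteq> H \<and> H \<subseteq> B}"
  let ?S = "\<lambda>K. \<Sum>H\<in>?I K G. moebius M H G"
  have fin: "finite (?I F G)" by simp
  have self: "moebius M G G = 1" using less.prems by (simp add: moebius.simps)
  show ?case
  proof (cases "F = G")
    case True
    then have "?I F G = {G}" using less.prems by auto
    with True self show ?thesis by simp
  next
    case False
    \<comment> \<open>Over the pairs \<open>K \<subseteq> H\<close> in the interval, summing over
      \<open>K\<close> first leaves only \<open>H = F\<close>.\<close>
    have "(\<Sum>K\<in>?I F G. moebius M F K * ?S K) =
        (\<Sum>K\<in>?I F G. \<Sum>H\<in>{H \<in> ?I F G. K \<subseteq> H}. moebius M F K * moebius M H G)"
      unfolding sum_distrib_left by (intro sum.cong refl) auto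
    also have "\<dots> = (\<Sum>H\<in>?I F G. \<Sum>K\<in>{K \<in> ?I F G. K \<subseteq> H}. moebius M F K * moebius M H G)"
      by (rule sum.swap_restrict[OF fin fin])
    also have "\<dots> = (\<Sum>H\<in>?I F G. (\<Sum>K\<in>?I F H. moebius M F K) * moebius M H G)"
      unfolding sum_distrib_right by (intro sum.cong refl) auto
    also have "\<dots> = (\<Sum>H\<in>?I F G. (if F = H then 1 else 0) * moebius M H G)"
      using less.prems by (intro sum.cong refl arg_cong2[of _ _ _ _ "(*)"] moebius_sum_upper) auto
    also have "\<dots> = (\<Sum>H\<in>?I F G. if F = H then moebius M H G else 0)"
      by (intro sum.cong) auto
    also have "\<dots> = moebius M F G"
      using less.prems by (subst sum.delta'[OF fin]) auto
    finally have convolution: "(\<Sum>K\<in>?I F G. moebius M F K * ?S K) = moebius M F G" .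
    have "?S K = (if K = G then 1 else 0)" if "K \<in> ?I F G - {F}" for K
    proof (rule less.hyps)
      have "G - K \<subset> G - F" using that by auto
      then show "card (G - K) < card (G - F)"
        using flat_finite[OF less.prems(2)] by (intro psubset_card_mono) auto
    qed (use that less.prems in auto)
    then have "(\<Sum>K\<in>?I F G - {F}. moebius M F K * ?S K) =
        (\<Sum>K\<in>?I F G - {F}. if K = G then moebius M F K else 0)"
      by (intro sum.cong) auto
    also have "\<dots> = moebius M F G"
      using False less.prems by (subst sum.delta) auto
    \<comment> \<open>The terms with \<open>K\<close> different from \<open>F\<close> already give
      the whole convolution, all of it coming from \<open>K = G\<close>, so the remaining term
      vanishes.\<close>
    finally have "moebius M F F * ?S F = 0"
      using convolution less.prems by (subst (asm) sum.remove[OF fin, of F]) auto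
    moreover have "moebius M F F = 1" using less.prems by (simp add: moebius.simps)
    ultimately show ?thesis using False by simp
  qed
qed

text \<open>Adding \<open>F\<close> identifies the interval from \<open>{}\<close> to
  \<open>K\<close> in the contraction with the one from \<open>F\<close> to
  \<open>K \<union> F\<close> in \<open>M\<close>, and the recursion for \<open>moebius\<close> sees
  only the interval.\<close>

lemma moebius_contract:
  assumes "F \<in> flats M" "K \<in> flats (matroid_contract M F)"
  shows "moebius (matroid_contract M F) {} K = moebius M F (K \<union> F)"
  using assms(2)
proof (induction "card K" arbitrary: K rule: less_induct)
  case less
  let ?N = "matroid_contract M F"
  note FE = flat_subset_ground[OF assms(1)]
  have K: "K \<subseteq> ground M - F" using flat_subset_ground[OF less.prems] by simp
  have bot: "{} \<in> flats ?N" by (rule empty_flat[OF loopless_contract[OF assms(1)]])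
  have KF: "K \<union> F \<in> flats M" using flats_contract_iff[OF FE K] less.prems by simp
  have bij: "bij_betw (\<lambda>L. L \<union> F) {L \<in> flats ?N. {} \<subseteq> L \<and> L \<subset> K}
      {H \<in> flats M. F \<subseteq> H \<and> H \<subset> K \<union> F}"
  proof (rule bij_betw_subset[OF bij_betw_flats_contract[OF FE]])
    show "(\<lambda>L. L \<union> F) ` {L \<in> flats ?N. {} \<subseteq> L \<and> L \<subset> K} = {H \<in> flats M. F \<subseteq> H \<and> H \<subset> K \<union> F}"
    proof (intro equalityI subsetI)
      fix H assume H: "H \<in> {H \<in> flats M. F \<subseteq> H \<and> H \<subset> K \<union> F}"
      then have eq: "H = H - F \<union> F" by auto
      have "H - F \<in> flats ?N"
        using H K eq flats_contract_iff[OF FE, of "H - F"] by auto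
      moreover have "H - F \<subset> K" using H K by auto
      ultimately show "H \<in> (\<lambda>L. L \<union> F) ` {L \<in> flats ?N. {} \<subseteq> L \<and> L \<subset> K}"
        using eq by blast
    next
      fix H assume "H \<in> (\<lambda>L. L \<union> F) ` {L \<in> flats ?N. {} \<subseteq> L \<and> L \<subset> K}"
      then obtain L where L: "L \<in> flats ?N" "L \<subset> K" "H = L \<union> F" by auto
      then have "L \<subseteq> ground M - F" using K by auto
      with L K flats_contract_iff[OF FE, of L]
      show "H \<in> {H \<in> flats M. F \<subseteq> H \<and> H \<subset> K \<union> F}" by auto
    qed
  qed auto
  have fin: "finite K" by (rule flat_finite[OF less.prems])
  show ?case
  proof (cases "K = {}")
    case True
    then show ?thesis using bot assms(1) by (simp add: moebius.simps)
  next
    case False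
    then have ne: "F \<noteq> K \<union> F" using K by auto
    have "moebius ?N {} K = - (\<Sum>L\<in>{L \<in> flats ?N. {} \<subseteq> L \<and> L \<subset> K}. moebius ?N {} L)"
      using bot less.prems False by (subst moebius.simps) simp
    also have "(\<Sum>L\<in>{L \<in> flats ?N. {} \<subseteq> L \<and> L \<subset> K}. moebius ?N {} L) =
        (\<Sum>L\<in>{L \<in> flats ?N. {} \<subseteq> L \<and> L \<subset> K}. moebius M F (L \<union> F))"
      using less.hyps fin by (intro sum.cong refl) (auto intro: psubset_card_mono)
    also have "\<dots> = (\<Sum>H\<in>{H \<in> flats M. F \<subseteq> H \<and> H \<subset> K \<union> F}. moebius M F H)"
      by (rule sum.reindex_bij_betw[OF bij])
    also have "- \<dots> = moebius M F (K \<union> F)"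
      using assms(1) KF ne by (subst (2) moebius.simps) auto
    finally show ?thesis .
  qed
qed

section \<open>Reduced characteristic polynomials of contractions at 1\<close>

lemma pderiv_sum: "pderiv (sum f A) = (\<Sum>x\<in>A. pderiv (f x))"
  using higher_pderiv_sum[of 1 f A] by simp

text \<open>The division by \<open>x - 1\<close> disappears because the reduced characteristic polynomial and the
  derivative of the characteristic polynomial have the same value at 1.\<close>
lemma reduced_char_poly_contract_at_1:
  assumes "F \<in> flats M" "F \<noteq> ground M"
  shows "poly (reduced_char_poly (matroid_contract M F)) 1 =
    (\<Sum>H\<in>{H \<in> flats M. F \<subseteq> H}. moebius M F H * (int (matroid_rank M) - int (rk M H)))"
proof -
  let ?N = "matroid_contract M F"
  note FE = flat_subset_ground[OF assms(1)]
  have top: "matroid_rank ?N + rk M F = matroid_rank M"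
    using rk_contract[of "ground M - F" M F] FE by (simp add: Un_absorb2)
  then have pos: "matroid_rank ?N > 0" using flat_rk_less[OF assms] by simp
  \<comment> \<open>The exponents in \<open>char_poly\<close> are truncated differences of naturals;
    monotonicity of the rank makes them true integer differences.\<close>
  have rk_diff: "int (matroid_rank ?N - rk ?N K) = int (matroid_rank M) - int (rk M (K \<union> F))"
    if "K \<in> flats ?N" for K
  proof -
    have K: "K \<subseteq> ground M - F" using flat_subset_ground[OF that] by simp
    have "rk ?N K \<le> matroid_rank ?N" using K by (intro rk_mono) simp
    then show ?thesis using rk_contract[OF K] top by simp
  qed
  \<comment> \<open>By the product rule the derivative of (x - 1) q is q + (x - 1) q', and the
    second term vanishes at 1.\<close>
  have "poly (reduced_char_poly ?N) 1 = poly (pderiv (char_poly ?N)) 1"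
    by (simp only: char_poly_eq_reduced[OF loopless_contract[OF assms(1)] pos]
        pderiv_mult poly_add poly_mult) (simp add: pderiv_pCons)
  also have "\<dots> = (\<Sum>K\<in>flats ?N. moebius ?N {} K * int (matroid_rank ?N - rk ?N K))"
    unfolding char_poly_def by (simp add: pderiv_sum pderiv_monom poly_sum poly_monom mult.commute)
  also have "\<dots> = (\<Sum>K\<in>flats ?N.
      moebius M F (K \<union> F) * (int (matroid_rank M) - int (rk M (K \<union> F))))"
    using assms(1) by (intro sum.cong refl) (simp only: moebius_contract rk_diff)
  also have "\<dots> = (\<Sum>H\<in>{H \<in> flats M. F \<subseteq> H}.
      moebius M F H * (int (matroid_rank M) - int (rk M H)))"
    by (rule sum.reindex_bij_betw[OF bij_betw_flats_contract[OF FE]])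
  finally show ?thesis .
qed

text \<open>The left side expands into a double sum over pairs of flats
  \<open>F \<subseteq> H\<close> above the closure \<open>G\<close> of \<open>A\<close>; summed over
  \<open>F\<close> first, \<open>moebius_sum_lower\<close> leaves only \<open>H = G\<close>.\<close>

lemma sum_reduced_char_poly_at_1:
  assumes "A \<subseteq> ground M"
  shows "(\<Sum>F\<in>{F \<in> flats M - {ground M}. A \<subseteq> F}.
      poly (reduced_char_poly (matroid_contract M F)) 1) =
    int (matroid_rank M) - int (rk M A)"
proof -
  define G where "G = closure M A"
  have G: "G \<in> flats M" "rk M G = rk M A"
    using closure_flat[OF assms] rk_closure[OF assms] by (simp_all add: G_def)
  let ?c = "\<lambda>H. int (matroid_rank M) - int (rk M H)"
  let ?U = "{H \<in> flats M. G \<subseteq> H}"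
  have fin: "finite ?U" by simp
  have sub: "A \<subseteq> F \<longleftrightarrow> G \<subseteq> F" if "F \<in> flats M" for F
    using closure_subset_flat_iff[OF assms that] by (simp add: G_def)
  have "(\<Sum>F\<in>{F \<in> flats M - {ground M}. A \<subseteq> F}.
      poly (reduced_char_poly (matroid_contract M F)) 1) =
      (\<Sum>F\<in>?U - {ground M}. \<Sum>H\<in>{H \<in> flats M. F \<subseteq> H}. moebius M F H * ?c H)"
    using reduced_char_poly_contract_at_1 sub by (intro sum.cong) auto
  \<comment> \<open>The top flat can be added: the only flat above it is \<open>ground M\<close>
    itself, where the factor \<open>?c\<close> is 0.\<close>
  also have "\<dots> = (\<Sum>F\<in>?U. \<Sum>H\<in>{H \<in> flats M. F \<subseteq> H}. moebius M F H * ?c H)"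
  proof (rule sum.mono_neutral_left)
    have "{H \<in> flats M. ground M \<subseteq> H} = {ground M}" by (auto dest: flat_subset_ground)
    then show "\<forall>F\<in>?U - (?U - {ground M}). (\<Sum>H\<in>{H \<in> flats M. F \<subseteq> H}. moebius M F H * ?c H) = 0"
      by auto
  qed auto
  also have "\<dots> = (\<Sum>F\<in>?U. \<Sum>H\<in>{H \<in> ?U. F \<subseteq> H}. moebius M F H * ?c H)"
    by (intro sum.cong refl) auto
  also have "\<dots> = (\<Sum>H\<in>?U. \<Sum>F\<in>{F \<in> ?U. F \<subseteq> H}. moebius M F H * ?c H)"
    by (rule sum.swap_restrict[OF fin fin])
  also have "\<dots> = (\<Sum>H\<in>?U. (\<Sum>F\<in>{F \<in> flats M. G \<subseteq> F \<and> F \<subseteq> H}. moebius M F H) * ?c H)"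
    unfolding sum_distrib_right by (intro sum.cong refl) auto
  also have "\<dots> = (\<Sum>H\<in>?U. if G = H then ?c H else 0)"
    using G(1) by (intro sum.cong refl) (subst moebius_sum_lower, auto)
  also have "\<dots> = ?c G"
    using G(1) by (subst sum.delta'[OF fin]) auto
  finally show ?thesis using G(2) by simp
qed

section \<open>Taylor coefficients of the zeta function\<close>

text \<open>Lists are read from the right: the prefixes of the tuple \<open>(e\<^sub>1, \<dots>, e\<^sub>i)\<close> are the suffixes of
  the list \<open>[e\<^sub>i, \<dots>, e\<^sub>1]\<close>.\<close>
fun prefix_weight :: "'a matroid \<Rightarrow> 'a list \<Rightarrow> rat" where
  "prefix_weight M [] = 1"
| "prefix_weight M (x # xs) = prefix_weight M xs / of_nat (rk M (set (x # xs)))"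

text \<open>The sign of the Taylor coefficient is left out, so that all terms are nonnegative;
  \<open>has_taylor_ztop\<close> restores it.\<close>

definition zeta_coeff :: "'a matroid \<Rightarrow> nat \<Rightarrow> rat" where
  "zeta_coeff M i = (\<Sum>xs\<in>{xs. set xs \<subseteq> ground M \<and> length xs = i}. prefix_weight M xs)"

lemma prefix_weight_restrict:
  "set xs \<subseteq> F \<Longrightarrow> prefix_weight (matroid_restrict M F) xs = prefix_weight M xs"
  by (induction xs) (simp_all add: rk_restrict)

lemma prefix_weight_nonneg: "0 \<le> prefix_weight M xs"
  by (induction xs) simp_all

lemma zeta_coeff_0: "zeta_coeff M 0 = 1"
proof -
  have "{xs. set xs \<subseteq> ground M \<and> length xs = 0} = {[]}" by auto
  then show ?thesis by (simp add: zeta_coeff_def)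
qed

lemma zeta_coeff_rank_0:
  assumes "loopless M" "matroid_rank M = 0"
  shows "zeta_coeff M (Suc i) = 0"
proof -
  have "ground M = {}" using loopless_rk_pos[OF assms(1), of "ground M"] assms(2) by auto
  then show ?thesis by (auto simp: zeta_coeff_def)
qed

text \<open>The factor \<open>rk M (set xs)\<close> cancels the denominator contributed by the head
  of the list, which then ranges freely over the ground set. Looplessness keeps this denominator
  nonzero.\<close>

lemma sum_prefix_weight_times_rk:
  assumes "loopless M"
  shows "(\<Sum>xs\<in>{xs. set xs \<subseteq> ground M \<and> length xs = Suc i}.
      prefix_weight M xs * of_nat (rk M (set xs))) = of_nat (card (ground M)) * zeta_coeff M i"
proof -
  let ?L = "{xs. set xs \<subseteq> ground M \<and> length xs = i}"
  have inj: "inj_on (\<lambda>(xs, x). x # xs) (?L \<times> ground M)" by (auto simp: inj_on_def)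
  have "(\<Sum>xs\<in>{xs. set xs \<subseteq> ground M \<and> length xs = Suc i}.
      prefix_weight M xs * of_nat (rk M (set xs))) =
      (\<Sum>(xs, x)\<in>?L \<times> ground M. prefix_weight M xs)"
    unfolding lists_length_Suc_eq sum.reindex[OF inj]
  proof (intro sum.cong refl)
    fix p assume "p \<in> ?L \<times> ground M"
    then obtain xs x where p: "p = (xs, x)" "set (x # xs) \<subseteq> ground M" by auto
    then have "0 < rk M (set (x # xs))" by (intro loopless_rk_pos[OF assms]) auto
    then show "((\<lambda>xs. prefix_weight M xs * of_nat (rk M (set xs))) \<circ> (\<lambda>(xs, x). x # xs)) p =
        (case p of (xs, x) \<Rightarrow> prefix_weight M xs)"
      using p(1) by simp
  qed
  also have "\<dots> = of_nat (card (ground M)) * zeta_coeff M i"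
    unfolding zeta_coeff_def by (simp add: sum.cartesian_product[symmetric] sum_distrib_left)
  finally show ?thesis .
qed

text \<open>Lists over the ground set of the restriction to \<open>F\<close> are the lists of
  \<open>M\<close> with entries in \<open>F\<close>, with unchanged weights. Exchanging the sums
  leaves, for each list, the sum evaluated in \<open>sum_reduced_char_poly_at_1\<close>.\<close>

lemma sum_zeta_coeff_restrict:
  "(\<Sum>F\<in>flats M - {ground M}. zeta_coeff (matroid_restrict M F) i *
      of_int (poly (reduced_char_poly (matroid_contract M F)) 1)) =
    (\<Sum>xs\<in>{xs. set xs \<subseteq> ground M \<and> length xs = i}.
      prefix_weight M xs * (of_nat (matroid_rank M) - of_nat (rk M (set xs))))"
proof -
  let ?L = "{xs. set xs \<subseteq> ground M \<and> length xs = i}"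
  let ?c = "\<lambda>F. poly (reduced_char_poly (matroid_contract M F)) 1"
  have fin: "finite ?L" using finite_lists_length_eq[of "ground M" i] by simp
  have "(\<Sum>F\<in>flats M - {ground M}. zeta_coeff (matroid_restrict M F) i * of_int (?c F)) =
      (\<Sum>F\<in>flats M - {ground M}. \<Sum>xs\<in>{xs \<in> ?L. set xs \<subseteq> F}. prefix_weight M xs * of_int (?c F))"
  proof (intro sum.cong refl)
    fix F assume "F \<in> flats M - {ground M}"
    then have "{xs. set xs \<subseteq> ground M \<inter> F \<and> length xs = i} = {xs \<in> ?L. set xs \<subseteq> F}" by auto
    then show "zeta_coeff (matroid_restrict M F) i * of_int (?c F) =
        (\<Sum>xs\<in>{xs \<in> ?L. set xs \<subseteq> F}. prefix_weight M xs * of_int (?c F))"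
      unfolding zeta_coeff_def sum_distrib_right
      by (intro sum.cong) (auto simp: prefix_weight_restrict)
  qed
  also have "\<dots> = (\<Sum>xs\<in>?L. \<Sum>F\<in>{F \<in> flats M - {ground M}. set xs \<subseteq> F}.
      prefix_weight M xs * of_int (?c F))"
    by (rule sum.swap_restrict[OF _ fin]) simp
  also have "\<dots> = (\<Sum>xs\<in>?L. prefix_weight M xs *
      of_int (\<Sum>F\<in>{F \<in> flats M - {ground M}. set xs \<subseteq> F}. ?c F))"
    by (simp add: sum_distrib_left)
  also have "\<dots> = (\<Sum>xs\<in>?L. prefix_weight M xs *
      (of_nat (matroid_rank M) - of_nat (rk M (set xs))))"
    by (intro sum.cong refl) (subst sum_reduced_char_poly_at_1, auto)
  finally show ?thesis .
qed

section \<open>Taylor expansions of rational functions at 0\<close>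

text \<open>Says that \<open>c\<close> is the expansion of \<open>f\<close> at 0, without dividing
  power series. The fraction need not be in lowest terms, so the closure properties reduce to
  cross-multiplication.\<close>

definition has_taylor :: "rat poly fract \<Rightarrow> rat fps \<Rightarrow> bool" where
  "has_taylor f c \<longleftrightarrow>
     (\<exists>p q. f = Fract p q \<and> poly q 0 \<noteq> 0 \<and> c * fps_of_poly q = fps_of_poly p)"

lemma has_taylorI:
  "poly q 0 \<noteq> 0 \<Longrightarrow> c * fps_of_poly q = fps_of_poly p \<Longrightarrow> has_taylor (Fract p q) c"
  by (auto simp: has_taylor_def)

lemma has_taylor_of_int: "has_taylor (of_int k) (of_int k)"
proof -
  have "of_int k = (Fract (of_int k) 1 :: rat poly fract)"
    by (cases k) (simp_all add: of_nat_fract One_fract_def)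
  moreover have "(of_int k :: rat fps) = fps_of_poly (of_int k)"
    by (simp add: of_int_poly fps_of_poly_const fps_of_int)
  ultimately show ?thesis using has_taylorI[of 1 "of_int k" "of_int k"] by simp
qed

lemma has_taylor_add:
  assumes "has_taylor f c" "has_taylor g d"
  shows "has_taylor (f + g) (c + d)"
proof -
  obtain p q p' q' where *: "f = Fract p q" "poly q 0 \<noteq> 0" "c * fps_of_poly q = fps_of_poly p"
      "g = Fract p' q'" "poly q' 0 \<noteq> 0" "d * fps_of_poly q' = fps_of_poly p'"
    using assms unfolding has_taylor_def by blast
  have "f + g = Fract (p * q' + p' * q) (q * q')"
    using * by (subst *, subst *(4), subst add_fract) auto
  moreover have "(c + d) * fps_of_poly (q * q') = fps_of_poly (p * q' + p' * q)"
    unfolding fps_of_poly_add fps_of_poly_mult *(3,6)[symmetric] by (simp add: algebra_simps)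
  ultimately show ?thesis using * by (simp add: has_taylorI)
qed

lemma has_taylor_mult:
  assumes "has_taylor f c" "has_taylor g d"
  shows "has_taylor (f * g) (c * d)"
proof -
  obtain p q p' q' where *: "f = Fract p q" "poly q 0 \<noteq> 0" "c * fps_of_poly q = fps_of_poly p"
      "g = Fract p' q'" "poly q' 0 \<noteq> 0" "d * fps_of_poly q' = fps_of_poly p'"
    using assms unfolding has_taylor_def by blast
  have "c * d * fps_of_poly (q * q') = fps_of_poly (p * p')"
    unfolding fps_of_poly_mult *(3,6)[symmetric] by (simp add: algebra_simps)
  with * show ?thesis by (simp add: has_taylorI)
qed

lemma has_taylor_sum:
  "(\<And>x. x \<in> A \<Longrightarrow> has_taylor (f x) (c x)) \<Longrightarrow> has_taylor (sum f A) (sum c A)"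
  using has_taylor_of_int[of 0]
  by (induction A rule: infinite_finite_induct) (auto intro: has_taylor_add)

text \<open>Meant for \<open>d\<close> equal to ns + r: the recursion for the zeta function can be
  verified after multiplying by this factor.\<close>

lemma has_taylor_divide:
  assumes "has_taylor f (c * fps_of_poly d)" "poly d 0 \<noteq> 0"
  shows "has_taylor (1 / to_fract d * f) c"
proof -
  obtain p q where *: "f = Fract p q" "poly q 0 \<noteq> 0" "c * fps_of_poly d * fps_of_poly q = fps_of_poly p"
    using assms(1) unfolding has_taylor_def by blast
  have "1 / to_fract d * f = Fract p (d * q)"
    by (simp add: *(1) to_fract_def One_fract_def)
  then show ?thesis
    using * assms(2) by (simp add: has_taylorI fps_of_poly_mult mult.assoc)
qed

text \<open>Substituting the series identity c q = p into the numerator p' q - p q' of the quotient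
  rule leaves c' times the square of q.\<close>

lemma has_taylor_deriv:
  assumes "has_taylor f c"
  shows "has_taylor (ratfun_deriv f) (fps_deriv c)"
proof -
  obtain p q where *: "f = Fract p q" "poly q 0 \<noteq> 0" "c * fps_of_poly q = fps_of_poly p"
    using assms unfolding has_taylor_def by blast
  then have "q \<noteq> 0" by auto
  moreover have "fps_deriv c * fps_of_poly (q ^ 2) = fps_of_poly (pderiv p * q - p * pderiv q)"
    unfolding fps_of_poly_diff fps_of_poly_mult fps_of_poly_pderiv fps_of_poly_power
      *(3)[symmetric]
    by (simp add: algebra_simps power2_eq_square)
  ultimately show ?thesis using *(1,2) by (simp add: ratfun_deriv_Fract has_taylorI)
qed

lemma has_taylor_eval:
  assumes "has_taylor f c"
  shows "ratfun_eval f 0 = fps_nth c 0"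
proof -
  obtain p q where *: "f = Fract p q" "poly q 0 \<noteq> 0" "c * fps_of_poly q = fps_of_poly p"
    using assms unfolding has_taylor_def by blast
  have "fps_nth c 0 * poly q 0 = poly p 0"
    using arg_cong[OF *(3), of "\<lambda>a. fps_nth a 0"] by (simp add: poly_0_coeff_0)
  then show ?thesis using *(1,2) by (auto simp: ratfun_eval_Fract field_simps)
qed

lemma has_taylor_eval_higher_deriv:
  assumes "has_taylor f c"
  shows "ratfun_eval ((ratfun_deriv ^^ i) f) 0 = fact i * fps_nth c i"
proof -
  have "has_taylor ((ratfun_deriv ^^ i) f) ((fps_deriv ^^ i) c)"
    using assms by (induction i) (auto intro: has_taylor_deriv)
  then show ?thesis by (simp add: has_taylor_eval fps_0th_higher_deriv)
qed

section \<open>Expansion of the zeta function at 0\<close>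

text \<open>Induction along the recursion of \<open>ztop\<close>: in positive rank, the claimed
  series of the proper restrictions, weighted as in the recursion, add up to ns + r times the
  claimed series of \<open>M\<close>.\<close>

lemma has_taylor_ztop:
  "loopless M \<Longrightarrow> has_taylor (ztop M) (Abs_fps (\<lambda>i. (-1) ^ i * zeta_coeff M i))"
proof (induction M rule: ztop.induct)
  case (1 M)
  let ?T = "\<lambda>M :: 'a matroid. Abs_fps (\<lambda>i. (-1) ^ i * zeta_coeff M i)"
  let ?c = "\<lambda>F. poly (reduced_char_poly (matroid_contract M F)) 1"
  show ?case
  proof (cases "matroid_rank M = 0")
    case True
    have "?T M = of_int 1"
    proof (rule fps_ext)
      show "fps_nth (?T M) i = fps_nth (of_int 1) i" for i
        using zeta_coeff_rank_0[OF 1(2) True] by (cases i) (simp_all add: zeta_coeff_0)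
    qed
    then show ?thesis
      using has_taylor_of_int[of 1] True by (subst ztop.simps) simp
  next
    case False
    let ?d = "[:of_nat (matroid_rank M), of_nat (card (ground M)):] :: rat poly"
    have "(\<Sum>F\<in>flats M - {ground M}. ?T (matroid_restrict M F) * of_int (?c F)) =
        ?T M * fps_of_poly ?d"
    proof (rule fps_ext)
      fix i
      let ?L = "{xs. set xs \<subseteq> ground M \<and> length xs = i}"
      have "fps_nth (\<Sum>F\<in>flats M - {ground M}. ?T (matroid_restrict M F) * of_int (?c F)) i =
          (-1) ^ i * (\<Sum>F\<in>flats M - {ground M}.
            zeta_coeff (matroid_restrict M F) i * of_int (?c F))"
        by (simp add: fps_sum_nth fps_of_int[symmetric] sum_distrib_left mult.assoc)
      also have "\<dots> = (-1) ^ i * (of_nat (matroid_rank M) * zeta_coeff M i -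
          (\<Sum>xs\<in>?L. prefix_weight M xs * of_nat (rk M (set xs))))"
        unfolding sum_zeta_coeff_restrict
        by (simp add: zeta_coeff_def right_diff_distrib sum_subtractf sum_distrib_left mult.commute)
      \<comment> \<open>The constant coefficient of \<open>?d\<close> gives the first term. The
        linear one shifts the index by one, which flips the sign and matches the subtracted sum by
        \<open>sum_prefix_weight_times_rk\<close>.\<close>
      also have "\<dots> = fps_nth (?T M * fps_of_poly ?d) i"
      proof (cases i)
        case 0
        \<comment> \<open>The only list is \<open>[]\<close>, whose set has rank 0, so the
          subtracted sum vanishes.\<close>
        then show ?thesis
          by (simp add: fps_of_poly_pCons zeta_coeff_0 conj_commute cong: conj_cong)
      next
        case (Suc j)
        have "fps_nth (?T M * fps_of_poly ?d) (Suc j) =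
            (-1) ^ Suc j * zeta_coeff M (Suc j) * of_nat (matroid_rank M) +
            (-1) ^ j * zeta_coeff M j * of_nat (card (ground M))"
          by (simp add: fps_of_poly_pCons distrib_left mult.assoc[symmetric])
        then show ?thesis
          unfolding Suc sum_prefix_weight_times_rk[OF 1(2)] by (simp add: algebra_simps)
      qed
      finally show "fps_nth (\<Sum>F\<in>flats M - {ground M}.
          ?T (matroid_restrict M F) * of_int (?c F)) i = fps_nth (?T M * fps_of_poly ?d) i" .
    qed
    moreover have "has_taylor
        (\<Sum>F\<in>flats M - {ground M}. ztop (matroid_restrict M F) * of_int (?c F))
        (\<Sum>F\<in>flats M - {ground M}. ?T (matroid_restrict M F) * of_int (?c F))"
      by (intro has_taylor_sum has_taylor_mult has_taylor_of_int
          1(1)[OF False] loopless_restrict 1(2))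
    ultimately show ?thesis
      using False by (subst ztop.simps) (simp only: if_False, intro has_taylor_divide, simp_all)
  qed
qed

theorem ztop_higher_deriv_at_0:
  assumes "loopless M"
  shows "(-1) ^ i * ratfun_eval ((ratfun_deriv ^^ i) (ztop M)) 0 = fact i * zeta_coeff M i"
proof -
  have "(-1) ^ i * ratfun_eval ((ratfun_deriv ^^ i) (ztop M)) 0 =
      ((-1) ^ i * (-1) ^ i) * (fact i * zeta_coeff M i)"
    using has_taylor_eval_higher_deriv[OF has_taylor_ztop[OF assms], of i] by simp
  then show ?thesis by (simp add: power_mult_distrib[symmetric])
qed

section \<open>Comparison with the uniform matroid\<close>

lemma rk_uniform:
  assumes "A \<subseteq> {..<n}"
  shows "rk (uniform_matroid r n) A = min r (card A)"
proof (rule antisym)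
  have fin: "finite A" using assms finite_subset by blast
  show "rk (uniform_matroid r n) A \<le> min r (card A)"
    using fin by (intro rk_le) (auto simp: indeps_uniform card_mono)
  obtain B where "B \<subseteq> A" "card B = min r (card A)"
    using obtain_subset_with_card_n[of "min r (card A)" A] by auto
  then show "min r (card A) \<le> rk (uniform_matroid r n) A"
    using card_le_rk[of B "uniform_matroid r n" A] assms by (auto simp: indeps_uniform)
qed

text \<open>No denominator shrinks when passing from \<open>M\<close> to \<open>N\<close>. Those of
  \<open>M\<close> are positive by looplessness, which excludes the default value 0 of a division by
  0.\<close>

lemma prefix_weight_antimono:
  assumes "loopless M" "E \<subseteq> ground M"
    and rk_le: "\<And>A. A \<subseteq> E \<Longrightarrow> rk M A \<le> rk N (f ` A)"
  shows "set xs \<subseteq> E \<Longrightarrow> prefix_weight N (map f xs) \<le> prefix_weight M xs"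
proof (induction xs)
  case (Cons x xs)
  have "0 < rk M (set (x # xs))" using Cons.prems assms(1,2) by (intro loopless_rk_pos) auto
  moreover have "rk M (set (x # xs)) \<le> rk N (set (map f (x # xs)))"
    using rk_le[of "set (x # xs)"] Cons.prems by simp
  ultimately show ?case
    using Cons prefix_weight_nonneg[of M xs] by (auto intro!: frac_le)
qed simp

text \<open>Mapping \<open>f\<close> over lists matches the index sets of the two sums, and the
  comparison is then term by term.\<close>

lemma zeta_coeff_antimono:
  assumes "bij_betw f (ground M) (ground N)" "loopless M"
    and "\<And>A. A \<subseteq> ground M \<Longrightarrow> rk M A \<le> rk N (f ` A)"
  shows "zeta_coeff N i \<le> zeta_coeff M i"
proof -
  have "bij_betw (map f) {xs. set xs \<subseteq> ground M \<and> length xs = i}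
      {xs. set xs \<subseteq> ground N \<and> length xs = i}"
  proof (rule bij_betwI[where g = "map (inv_into (ground M) f)"])
    have "inv_into (ground M) f y \<in> ground M" if "y \<in> ground N" for y
      using bij_betw_inv_into[OF assms(1)] that by (rule bij_betwE[THEN bspec])
    then show "map (inv_into (ground M) f) \<in> {xs. set xs \<subseteq> ground N \<and> length xs = i} \<rightarrow>
        {xs. set xs \<subseteq> ground M \<and> length xs = i}" by fastforce
    show "map f \<in> {xs. set xs \<subseteq> ground M \<and> length xs = i} \<rightarrow>
        {xs. set xs \<subseteq> ground N \<and> length xs = i}"
      using bij_betwE[OF assms(1)] by fastforce
  qed (use bij_betw_inv_into_left[OF assms(1)] bij_betw_inv_into_right[OF assms(1)]
      in \<open>auto intro!: map_idI\<close>)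
  then have "zeta_coeff N i =
      (\<Sum>xs\<in>{xs. set xs \<subseteq> ground M \<and> length xs = i}. prefix_weight N (map f xs))"
    unfolding zeta_coeff_def by (rule sum.reindex_bij_betw[symmetric])
  also have "\<dots> \<le> zeta_coeff M i"
    unfolding zeta_coeff_def
    using prefix_weight_antimono[OF assms(2) subset_refl assms(3)]
    by (intro sum_mono) blast
  finally show ?thesis .
qed

theorem theorem1p5:
  fixes M :: "'a matroid" and r n i :: nat
  assumes "loopless M"
    and "matroid_rank M = r"
    and "card (ground M) = n"
  shows "(-1) ^ i * ratfun_eval ((ratfun_deriv ^^ i) (ztop M)) 0
       \<ge> (-1) ^ i * ratfun_eval ((ratfun_deriv ^^ i) (ztop (uniform_matroid r n))) 0"
proof -
  \<comment> \<open>Any bijection serves, since the rank in the uniform matroid depends only on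
    cardinality.\<close>
  obtain f where f: "bij_betw f (ground M) {..<n}"
    using ex_bij_betw_finite_nat[OF finite_ground[of M]] assms(3) by (auto simp: atLeast0LessThan)
  \<comment> \<open>For \<open>r = 0\<close> no singleton is independent in the uniform matroid, but
    \<open>M\<close>, loopless of rank 0, then has no elements, so \<open>n = 0\<close>.\<close>
  have "loopless (uniform_matroid r n)"
  proof (cases "r = 0")
    case True
    then have "n = 0"
      using loopless_rk_pos[OF assms(1), of "ground M"] assms(2,3) by fastforce
    then show ?thesis by (simp add: loopless_def)
  qed (auto simp: loopless_def indeps_uniform)
  moreover have "zeta_coeff (uniform_matroid r n) i \<le> zeta_coeff M i"
  proof (rule zeta_coeff_antimono)
    fix A assume A: "A \<subseteq> ground M"
    have "card (f ` A) = card A"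
      by (rule card_image[OF inj_on_subset[OF bij_betw_imp_inj_on[OF f] A]])
    moreover have "f ` A \<subseteq> {..<n}" using bij_betw_imp_surj_on[OF f] A by auto
    ultimately show "rk M A \<le> rk (uniform_matroid r n) (f ` A)"
      using rk_mono[OF A, of M] rk_le_card[OF finite_subset[OF A finite_ground], of M] assms(2)
      by (simp add: rk_uniform)
  qed (use f assms(1) in auto)
  ultimately show ?thesis
    using assms(1) by (simp add: ztop_higher_deriv_at_0)
qed

end
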